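(* Let $(K_1^{(0)},\dots,K_{\mathbf K}^{(0)})$ be a stabilizer of the system (S) of the context, and for $i=0,1,2,\dots$ let $(P_1^{(i+1)},\dots,P_{\mathbf K}^{(i+1)})$ be the solution of the coupled equations $$(A_k+B_kK_k^{(i)})^\top P_k^{(i+1)}+P_k^{(i+1)}(A_k+B_kK_k^{(i)})+(C_k+D_kK_k^{(i)})^\top P_k^{(i+1)}(C_k+D_kK_k^{(i)})+\sum_{j=1}^{\mathbf K}\pi_{kj}P_j^{(i+1)}+K_k^{(i)\top}R_kK_k^{(i)}+S_k^\top K_k^{(i)}+K_k^{(i)\top}S_k+N_k=0,\quad k\in\mathcal M,$$ and let $$K_k^{(i+1)}=-(R_k+D_k^\top P_k^{(i+1)}D_k)^{-1}(B_k^\top P_k^{(i+1)}+D_k^\top P_k^{(i+1)}C_k+S_k),\quad k\in\mathcal M .$$ Then the sequence $\{(P_1^{(i)},\dots,P_{\mathbf K}^{(i)})\}_{i=1}^\infty$ converges, as $i\to\infty$, to the solution $(P_1,\dots,P_{\mathbf K})\in(\mathcal S^n_{++})^{\mathbf K}$ of the coupled generalized algebraic Riccati equations $$A_k^\top P_k+P_kA_k+C_k^\top P_kC_k+N_k+\sum_{j=1}^{\mathbf K}\pi_{kj}P_j-(P_kB_k+C_k^\top P_kD_k+S_k^\top)(R_k+D_k^\top P_kD_k)^{-1}(B_k^\top P_k+D_k^\top P_kC_k+S_k)=0,\quad k\in\mathcal M .$$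
   Context: $\mathcal S^n$, $\mathcal S^n_+$, $\mathcal S^n_{++}$ denote the sets of real $n\times n$ symmetric, symmetric positive semidefinite, and symmetric positive definite matrices. $(\Omega,\mathcal F,\mathbb F,\mathbb P)$ is a filtered probability space carrying a standard one-dimensional Brownian motion $W$ and an independent continuous-time stationary Markov chain $\alpha$ with values in $\mathcal M=\{1,\dots,\mathbf K\}$, $\mathbf K>1$, with generator $(\pi_{kj})_{k,j\in\mathcal M}$, where $\pi_{kj}\ge 0$ for $k\ne j$ and $\pi_{kk}=-\sum_{j\neq k}\pi_{kj}$; $\mathbb F=\{\mathcal F_s\}_{s\ge 0}$ is the filtration generated by $W$ and $\alpha$, augmented by all null sets. System (S), for initial data $(t,x,k)\in[0,\infty)\times\mathbb R^n\times\mathcal M$: $$dX(s)=[A(\alpha_s)X(s)+B(\alpha_s)u(s)]ds+[C(\alpha_s)X(s)+D(\alpha_s)u(s)]dW(s),\ s\ge t,\quad X(t)=x,\ \alpha_t=k,$$ where $u$ is $\mathbb R^r$-valued and $A(\alpha_s)=A_k$, $B(\alpha_s)=B_k$, $C(\alpha_s)=C_k$, $D(\alpha_s)=D_k$ when $\alpha_s=k$, for given real matrices $A_k,C_k\in\mathbb R^{n\times n}$, $B_k,D_k\in\mathbb R^{n\times r}$. Weights: $N_k\in\mathcal S^n$, $R_k\in\mathcal S^r$, $S_k\in\mathbb R^{r\times n}$. Standing assumption: $R_k>0$ and $N_k-S_k^\top R_k^{-1}S_k>0$ for all $k\in\mathcal M$. A control $u(\cdot)$ is mean-square stabilizing with respect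 to $(t,x,k)$ if the corresponding state satisfies $\lim_{s\to\infty}\mathbb E[X(s)^\top X(s)]=0$. A tuple $(K_1,\dots,K_{\mathbf K})$ of matrices in $\mathbb R^{r\times n}$ is a stabilizer of (S) if the feedback control $u(s)=\sum_{k=1}^{\mathbf K}K_kX(s)\chi_{\{\alpha_s=k\}}(s)$ is mean-square stabilizing for every initial $(t,x,k)$; here $\chi$ denotes the indicator function. When the initial tuple $(K_1^{(0)},\dots,K_{\mathbf K}^{(0)})$ is a stabilizer, consider the iteration which at step $i=0,1,2,\dots$ solves, for the unknowns $P_k^{(i+1)}$, $k\in\mathcal M$, the coupled equations $$(A_k+B_kK_k^{(i)})^\top P_k^{(i+1)}+P_k^{(i+1)}(A_k+B_kK_k^{(i)})+(C_k+D_kK_k^{(i)})^\top P_k^{(i+1)}(C_k+D_kK_k^{(i)})+\sum_{j=1}^{\mathbf K}\pi_{kj}P_j^{(i+1)}+K_k^{(i)\top}R_kK_k^{(i)}+S_k^\top K_k^{(i)}+K_k^{(i)\top}S_k+N_k=0,\quad k\in\mathcal M,$$ and then sets $K_k^{(i+1)}=-(R_k+D_k^\top P_k^{(i+1)}D_k)^{-1}(B_k^\top P_k^{(i+1)}+D_k^\top P_k^{(i+1)}C_k+S_k)$, $k\in\mathcal M$. Each step of this iteration has a unique solution in $(\mathcal S^n_{++})^{\mathbf K}$, so the sequence $\{(P_1^{(i)},\dots,P_{\mathbf K}^{(i)})\}_{i=1}^\infty$ is well defined. *)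

theory Defs
  imports "HOL-Probability.Probability"
begin

section \<open>The driving processes\<close>

definition process_events :: "'w measure \<Rightarrow> 's measure \<Rightarrow> (real \<Rightarrow> 'w \<Rightarrow> 's) \<Rightarrow> real set \<Rightarrow> 'w set set"
  where "process_events M S Y T = (\<Union>v\<in>T. {Y v -` E \<inter> space M | E. E \<in> sets S})"

definition brownian_motion :: "'w measure \<Rightarrow> (real \<Rightarrow> 'w \<Rightarrow> real) \<Rightarrow> bool"
  where "brownian_motion M W \<longleftrightarrow>
    (\<forall>s\<ge>0. W s \<in> borel_measurable M) \<and>
    (AE \<omega> in M. W 0 \<omega> = 0) \<and>
    (\<forall>\<omega>\<in>space M. continuous_on {0..} (\<lambda>s. W s \<omega>)) \<and>
    (\<forall>s\<ge>0. \<forall>h>0. distributed M lborel (\<lambda>\<omega>. W (s + h) \<omega> - W s \<omega>) (normal_density 0 (sqrt h))) \<and>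
    (\<forall>\<tau> m. 0 \<le> \<tau> 0 \<and> (\<forall>i<m. \<tau> i < \<tau> (Suc i)) \<longrightarrow>
       prob_space.indep_vars M (\<lambda>_. borel)
         (\<lambda>i \<omega>. W (\<tau> (Suc i)) \<omega> - W (\<tau> i) \<omega>) {..<m::nat})"

text \<open>The finite mode set is the index type \<open>'k\<close>.\<close>

definition generator_matrix :: "('k::finite \<Rightarrow> 'k \<Rightarrow> real) \<Rightarrow> bool"
  where "generator_matrix \<pi> \<longleftrightarrow>
    (\<forall>k j. k \<noteq> j \<longrightarrow> 0 \<le> \<pi> k j) \<and> (\<forall>k. \<pi> k k = - (\<Sum>j\<in>UNIV - {k}. \<pi> k j))"

text \<open>\<open>p h k j\<close> is the probability of going from \<open>k\<close> to \<open>j\<close> in time \<open>h\<close>; that \<open>p\<close> depends on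
  the elapsed time only is the stationarity (time homogeneity) of the chain.\<close>

definition transition_semigroup ::
    "('k::finite \<Rightarrow> 'k \<Rightarrow> real) \<Rightarrow> (real \<Rightarrow> 'k \<Rightarrow> 'k \<Rightarrow> real) \<Rightarrow> bool"
  where "transition_semigroup \<pi> p \<longleftrightarrow>
    (\<forall>h\<ge>0. \<forall>k. (\<forall>j. 0 \<le> p h k j) \<and> (\<Sum>j\<in>UNIV. p h k j) = 1) \<and>
    (\<forall>k j. p 0 k j = (if k = j then 1 else 0)) \<and>
    (\<forall>h\<ge>0. \<forall>h'\<ge>0. \<forall>k j. p (h + h') k j = (\<Sum>l\<in>UNIV. p h k l * p h' l j)) \<and>
    (\<forall>k j. ((\<lambda>h. p h k j) has_real_derivative \<pi> k j) (at 0 within {0..}))"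

text \<open>A Markov chain \<open>a\<close> on the times from \<open>t\<close> on, with generator \<open>\<pi>\<close> and with right-continuous
  paths that have left limits. The Markov property is written without conditional probabilities,
  which avoids conditioning on events of probability zero.\<close>

definition markov_chain ::
    "'w measure \<Rightarrow> ('k::finite \<Rightarrow> 'k \<Rightarrow> real) \<Rightarrow> real \<Rightarrow> (real \<Rightarrow> 'w \<Rightarrow> 'k) \<Rightarrow> bool"
  where "markov_chain M \<pi> t a \<longleftrightarrow>
    (\<forall>s\<ge>t. a s \<in> measurable M (count_space UNIV)) \<and>
    (\<forall>\<omega>\<in>space M. \<forall>s\<ge>t. \<forall>\<^sub>F v in at_right s. a v \<omega> = a s \<omega>) \<and>
    (\<forall>\<omega>\<in>space M. \<forall>s>t. \<exists>j. \<forall>\<^sub>F v in at_left s. a v \<omega> = j) \<and>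
    (\<exists>p. transition_semigroup \<pi> p \<and>
      (\<forall>\<tau> c m. t \<le> \<tau> 0 \<and> (\<forall>i\<le>m. \<tau> i < \<tau> (Suc i)) \<longrightarrow>
         measure M {\<omega> \<in> space M. \<forall>i\<le>Suc m. a (\<tau> i) \<omega> = c i} =
         measure M {\<omega> \<in> space M. \<forall>i\<le>m. a (\<tau> i) \<omega> = c i} *
           p (\<tau> (Suc m) - \<tau> m) (c m) (c (Suc m))))"

text \<open>The prescription \<open>\<alpha>\<^sub>t = k\<close> is part of the initial data of the controlled system, and it is to be
  met for every \<open>t\<close> and \<open>k\<close>. So, like the state process, the chain carries its initial data:
  \<open>\<alpha> t k\<close> is the chain on the times from \<open>t\<close> on that starts in mode \<open>k\<close> at time \<open>t\<close>. All these
  chains have the same generator and live on one probability space with one Brownian motion.\<close>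

definition switching_chains ::
    "'w measure \<Rightarrow> (real \<Rightarrow> 'w \<Rightarrow> real) \<Rightarrow> ('k::finite \<Rightarrow> 'k \<Rightarrow> real) \<Rightarrow>
     (real \<Rightarrow> 'k \<Rightarrow> real \<Rightarrow> 'w \<Rightarrow> 'k) \<Rightarrow> bool"
  where "switching_chains M W \<pi> \<alpha> \<longleftrightarrow> (\<forall>t\<ge>0. \<forall>k.
    markov_chain M \<pi> t (\<alpha> t k) \<and>
    (AE \<omega> in M. \<alpha> t k t \<omega> = k) \<and>
    prob_space.indep_set M
      (sigma_sets (space M) (process_events M borel W {0..}))
      (sigma_sets (space M) (process_events M (count_space UNIV) (\<alpha> t k) {t..})))"

definition driving_filtration ::
    "'w measure \<Rightarrow> (real \<Rightarrow> 'w \<Rightarrow> real) \<Rightarrow> (real \<Rightarrow> 'w \<Rightarrow> 'k) \<Rightarrow> real \<Rightarrow> real \<Rightarrow> 'w measure"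
  where "driving_filtration M W a t s =
    sigma (space M) (process_events M borel W {0..s} \<union>
      process_events M (count_space UNIV) a {t..s} \<union> null_sets M)"

section \<open>The stochastic integral\<close>

definition prog_measurable ::
    "(real \<Rightarrow> 'w measure) \<Rightarrow> real \<Rightarrow> (real \<Rightarrow> 'w \<Rightarrow> 'v::euclidean_space) \<Rightarrow> bool"
  where "prog_measurable F t Y \<longleftrightarrow>
    (\<forall>T\<ge>t. (\<lambda>(s, \<omega>). Y s \<omega>) \<in> borel_measurable (restrict_space borel {t..T} \<Otimes>\<^sub>M F T))"

definition simple_integrand ::
    "(real \<Rightarrow> 'w measure) \<Rightarrow> real \<Rightarrow> real \<Rightarrow> nat \<Rightarrow> (nat \<Rightarrow> real) \<Rightarrow>
     (nat \<Rightarrow> 'w \<Rightarrow> 'v::euclidean_space) \<Rightarrow> bool"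
  where "simple_integrand F a b m \<tau> \<xi> \<longleftrightarrow>
    \<tau> 0 = a \<and> \<tau> m = b \<and> (\<forall>i<m. \<tau> i \<le> \<tau> (Suc i)) \<and>
    (\<forall>i<m. \<xi> i \<in> borel_measurable (F (\<tau> i)) \<and>
       (\<exists>c. \<forall>\<omega>\<in>space (F (\<tau> i)). norm (\<xi> i \<omega>) \<le> c))"

definition simple_process ::
    "nat \<Rightarrow> (nat \<Rightarrow> real) \<Rightarrow> (nat \<Rightarrow> 'w \<Rightarrow> 'v::euclidean_space) \<Rightarrow> real \<Rightarrow> 'w \<Rightarrow> 'v"
  where "simple_process m \<tau> \<xi> v \<omega> = (\<Sum>i<m. indicator {\<tau> i<..\<tau> (Suc i)} v *\<^sub>R \<xi> i \<omega>)"

definition simple_integral ::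
    "(real \<Rightarrow> 'w \<Rightarrow> real) \<Rightarrow> nat \<Rightarrow> (nat \<Rightarrow> real) \<Rightarrow> (nat \<Rightarrow> 'w \<Rightarrow> 'v::euclidean_space) \<Rightarrow> 'w \<Rightarrow> 'v"
  where "simple_integral W m \<tau> \<xi> \<omega> = (\<Sum>i<m. (W (\<tau> (Suc i)) \<omega> - W (\<tau> i) \<omega>) *\<^sub>R \<xi> i \<omega>)"

text \<open>\<open>J\<close> is a version of the Ito integral of \<open>\<phi>\<close> over \<open>[a, b]\<close>, that is, the mean-square limit of
  the integrals of simple adapted processes that approximate \<open>\<phi>\<close> in mean square.
  Nonnegative integrals are used because they take the value \<open>\<infinity>\<close> on non-integrable functions.\<close>

definition has_ito_integral ::
    "'w measure \<Rightarrow> (real \<Rightarrow> 'w measure) \<Rightarrow> (real \<Rightarrow> 'w \<Rightarrow> real) \<Rightarrow> (real \<Rightarrow> 'w \<Rightarrow> 'v::euclidean_space) \<Rightarrow>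
     real \<Rightarrow> real \<Rightarrow> ('w \<Rightarrow> 'v) \<Rightarrow> bool"
  where "has_ito_integral M F W \<phi> a b J \<longleftrightarrow>
    prog_measurable F a \<phi> \<and> J \<in> borel_measurable M \<and>
    (\<exists>m \<tau> \<xi>. (\<forall>l::nat. simple_integrand F a b (m l) (\<tau> l) (\<xi> l)) \<and>
      (\<lambda>l. \<integral>\<^sup>+\<omega>. (\<integral>\<^sup>+v\<in>{a..b}.
          ennreal ((norm (simple_process (m l) (\<tau> l) (\<xi> l) v \<omega> - \<phi> v \<omega>))\<^sup>2) \<partial>lborel) \<partial>M)
        \<longlonglongrightarrow> 0 \<and>
      (\<lambda>l. \<integral>\<^sup>+\<omega>. ennreal ((norm (simple_integral W (m l) (\<tau> l) (\<xi> l) \<omega> - J \<omega>))\<^sup>2) \<partial>M)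
        \<longlonglongrightarrow> 0)"

section \<open>The controlled system and its stabilizers\<close>

definition admissible_control ::
    "'w measure \<Rightarrow> (real \<Rightarrow> 'w measure) \<Rightarrow> real \<Rightarrow> (real \<Rightarrow> 'w \<Rightarrow> 'v::euclidean_space) \<Rightarrow> bool"
  where "admissible_control M F t u \<longleftrightarrow> prog_measurable F t u \<and>
    (\<forall>T\<ge>t. (\<integral>\<^sup>+\<omega>. (\<integral>\<^sup>+s\<in>{t..T}. ennreal ((norm (u s \<omega>))\<^sup>2) \<partial>lborel) \<partial>M) < \<infinity>)"

text \<open>\<open>X\<close> is the state under the control \<open>u\<close> for the initial data \<open>X(t) = x\<close> and a chain \<open>a\<close> whose
  mode at time \<open>t\<close> is the prescribed one. States are unique up to indistinguishability. The
  Bochner expectation of a non-integrable function is \<open>0\<close>, hence the explicit integrability of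
  \<open>X(s)\<^sup>T X(s)\<close>.\<close>

definition is_state ::
    "'w measure \<Rightarrow> (real \<Rightarrow> 'w \<Rightarrow> real) \<Rightarrow> (real \<Rightarrow> 'w \<Rightarrow> 'k) \<Rightarrow>
     ('k \<Rightarrow> real^'n^'n) \<Rightarrow> ('k \<Rightarrow> real^'r^'n) \<Rightarrow> ('k \<Rightarrow> real^'n^'n) \<Rightarrow> ('k \<Rightarrow> real^'r^'n) \<Rightarrow>
     real \<Rightarrow> real^'n \<Rightarrow> (real \<Rightarrow> 'w \<Rightarrow> real^'r) \<Rightarrow> (real \<Rightarrow> 'w \<Rightarrow> real^'n) \<Rightarrow> bool"
  where "is_state M W a A B C D t x u X \<longleftrightarrow>
    (let F = driving_filtration M W a t;
         drift = (\<lambda>v \<omega>. A (a v \<omega>) *v X v \<omega> + B (a v \<omega>) *v u v \<omega>);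
         diffusion = (\<lambda>v \<omega>. C (a v \<omega>) *v X v \<omega> + D (a v \<omega>) *v u v \<omega>)
     in admissible_control M F t u \<and>
        (\<forall>s\<ge>t. X s \<in> borel_measurable (F s)) \<and>
        (\<forall>\<omega>\<in>space M. continuous_on {t..} (\<lambda>s. X s \<omega>)) \<and>
        (\<forall>s\<ge>t. integrable M (\<lambda>\<omega>. X s \<omega> \<bullet> X s \<omega>)) \<and>
        (\<forall>s\<ge>t. \<exists>J. has_ito_integral M F W diffusion t s J \<and>
           (AE \<omega> in M. set_integrable lborel {t..s} (\<lambda>v. drift v \<omega>) \<and>
              X s \<omega> = x + (LINT v:{t..s}|lborel. drift v \<omega>) + J \<omega>)))"

definition ms_stabilizing ::
    "'w measure \<Rightarrow> (real \<Rightarrow> 'w \<Rightarrow> real) \<Rightarrow> (real \<Rightarrow> 'w \<Rightarrow> 'k) \<Rightarrow>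
     ('k \<Rightarrow> real^'n^'n) \<Rightarrow> ('k \<Rightarrow> real^'r^'n) \<Rightarrow> ('k \<Rightarrow> real^'n^'n) \<Rightarrow> ('k \<Rightarrow> real^'r^'n) \<Rightarrow>
     real \<Rightarrow> real^'n \<Rightarrow> (real \<Rightarrow> 'w \<Rightarrow> real^'r) \<Rightarrow> bool"
  where "ms_stabilizing M W a A B C D t x u \<longleftrightarrow>
    (\<exists>X. is_state M W a A B C D t x u X \<and>
       ((\<lambda>s. LINT \<omega>|M. X s \<omega> \<bullet> X s \<omega>) \<longlongrightarrow> 0) at_top)"

definition feedback ::
    "('k::finite \<Rightarrow> real^'n^'r) \<Rightarrow> (real \<Rightarrow> 'w \<Rightarrow> 'k) \<Rightarrow> (real \<Rightarrow> 'w \<Rightarrow> real^'n) \<Rightarrow> real \<Rightarrow> 'w \<Rightarrow> real^'r"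
  where "feedback K a X s \<omega> = (\<Sum>k\<in>UNIV. indicator {\<omega>'. a s \<omega>' = k} \<omega> *\<^sub>R (K k *v X s \<omega>))"

definition stabilizer ::
    "'w measure \<Rightarrow> (real \<Rightarrow> 'w \<Rightarrow> real) \<Rightarrow> (real \<Rightarrow> 'k::finite \<Rightarrow> real \<Rightarrow> 'w \<Rightarrow> 'k) \<Rightarrow>
     ('k \<Rightarrow> real^'n^'n) \<Rightarrow> ('k \<Rightarrow> real^'r^'n) \<Rightarrow> ('k \<Rightarrow> real^'n^'n) \<Rightarrow> ('k \<Rightarrow> real^'r^'n) \<Rightarrow>
     ('k \<Rightarrow> real^'n^'r) \<Rightarrow> bool"
  where "stabilizer M W \<alpha> A B C D K \<longleftrightarrow>
    (\<forall>t\<ge>0. \<forall>x k. \<exists>X.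
       is_state M W (\<alpha> t k) A B C D t x (feedback K (\<alpha> t k) X) X \<and>
       ms_stabilizing M W (\<alpha> t k) A B C D t x (feedback K (\<alpha> t k) X))"

section \<open>The matrix equations\<close>

definition sym_posdef :: "real^'n^'n \<Rightarrow> bool"
  where "sym_posdef Q \<longleftrightarrow> transpose Q = Q \<and> (\<forall>x. x \<noteq> 0 \<longrightarrow> 0 < x \<bullet> (Q *v x))"

definition solves_lyapunov ::
    "('k::finite \<Rightarrow> real^'n^'n) \<Rightarrow> ('k \<Rightarrow> real^'r^'n) \<Rightarrow> ('k \<Rightarrow> real^'n^'n) \<Rightarrow> ('k \<Rightarrow> real^'r^'n) \<Rightarrow>
     ('k \<Rightarrow> 'k \<Rightarrow> real) \<Rightarrow> ('k \<Rightarrow> real^'n^'n) \<Rightarrow> ('k \<Rightarrow> real^'r^'r) \<Rightarrow> ('k \<Rightarrow> real^'n^'r) \<Rightarrow>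
     ('k \<Rightarrow> real^'n^'r) \<Rightarrow> ('k \<Rightarrow> real^'n^'n) \<Rightarrow> bool"
  where "solves_lyapunov A B C D \<pi> N R S K P \<longleftrightarrow> (\<forall>k.
    transpose (A k + B k ** K k) ** P k + P k ** (A k + B k ** K k)
    + transpose (C k + D k ** K k) ** P k ** (C k + D k ** K k)
    + (\<Sum>j\<in>UNIV. \<pi> k j *\<^sub>R P j)
    + transpose (K k) ** R k ** K k + transpose (S k) ** K k + transpose (K k) ** S k + N k = 0)"

definition gain ::
    "('k \<Rightarrow> real^'r^'n) \<Rightarrow> ('k \<Rightarrow> real^'n^'n) \<Rightarrow> ('k \<Rightarrow> real^'r^'n) \<Rightarrow>
     ('k \<Rightarrow> real^'r^'r) \<Rightarrow> ('k \<Rightarrow> real^'n^'r) \<Rightarrow> ('k \<Rightarrow> real^'n^'n) \<Rightarrow> 'k \<Rightarrow> real^'n^'r"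
  where "gain B C D R S P k =
    - (matrix_inv (R k + transpose (D k) ** P k ** D k)
       ** (transpose (B k) ** P k + transpose (D k) ** P k ** C k + S k))"

definition solves_riccati ::
    "('k::finite \<Rightarrow> real^'n^'n) \<Rightarrow> ('k \<Rightarrow> real^'r^'n) \<Rightarrow> ('k \<Rightarrow> real^'n^'n) \<Rightarrow> ('k \<Rightarrow> real^'r^'n) \<Rightarrow>
     ('k \<Rightarrow> 'k \<Rightarrow> real) \<Rightarrow> ('k \<Rightarrow> real^'n^'n) \<Rightarrow> ('k \<Rightarrow> real^'r^'r) \<Rightarrow> ('k \<Rightarrow> real^'n^'r) \<Rightarrow>
     ('k \<Rightarrow> real^'n^'n) \<Rightarrow> bool"
  where "solves_riccati A B C D \<pi> N R S P \<longleftrightarrow> (\<forall>k.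
    transpose (A k) ** P k + P k ** A k + transpose (C k) ** P k ** C k + N k
    + (\<Sum>j\<in>UNIV. \<pi> k j *\<^sub>R P j)
    - (P k ** B k + transpose (C k) ** P k ** D k + transpose (S k))
      ** matrix_inv (R k + transpose (D k) ** P k ** D k)
      ** (transpose (B k) ** P k + transpose (D k) ** P k ** C k + S k) = 0)"

end

theory Submission
  imports Defs
begin

text \<open>The equations are read as statements about quadratic forms. For a tuple \<open>P\<close> let
  \<open>hamiltonian P k x u\<close> be the expected rate of change of \<open>x \<bullet> P\<^sub>k x\<close> along the controlled system in state
  \<open>(x, k)\<close> under the input \<open>u\<close>, plus the running cost. The Lyapunov equation for the gains \<open>K\<close> says
  that the Hamiltonian vanishes at \<open>u = K\<^sub>k x\<close>. For positive semidefinite \<open>P\<close> it is a strictly convex quadratic in \<open>u\<close> whose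
  minimizer is the next gain of the iteration applied to \<open>x\<close> (\<open>hamiltonian_complete_square\<close>), and
  the Riccati equation says that its minimum is \<open>0\<close> (\<open>riccati_iff_hamiltonian_zero\<close>). So the
  iteration is policy iteration: evaluate a feedback, then minimize.

  Everything else rests on a comparison principle (\<open>generator_form_comparison\<close>). The running cost
  is positive for \<open>x \<noteq> 0\<close> (\<open>running_cost_pos\<close>), so a positive definite solution of the Lyapunov
  equation for \<open>K\<close> is itself a strict Lyapunov function of the system closed by \<open>K\<close>, and the
  closed-loop Lyapunov operator then reverses signs: if it maps \<open>H\<close> to a tuple of nonnegative
  forms, the forms of \<open>H\<close> are nonpositive. This is a maximum principle: look at the mode and
  direction in which the ratio of the form of \<open>H\<close> to the form of the Lyapunov function is largest.

  Minimizing brings the Hamiltonian of the current \<open>P\<close> from \<open>0\<close> to at most \<open>0\<close>, whereas the next \<open>P\<close> has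
  Hamiltonian \<open>0\<close> at the same feedback, so by comparison the forms decrease
  (\<open>hamiltonian_comparison\<close>). Bounded below by \<open>0\<close>, they converge; since the gain is a continuous
  function of \<open>P\<close>, the limit solves the Riccati equation, and it is positive definite because
  the running cost is positive (\<open>evaluation_posdef\<close>). Two positive definite Riccati solutions dominate
  each other by the same comparison, hence coincide (\<open>riccati_unique\<close>).\<close>

section \<open>Symmetric matrices and their quadratic forms\<close>

lemma inner_vector_matrix_mult:
  fixes A :: "real^'n^'m"
  shows "x \<bullet> (y v* A) = (A *v x) \<bullet> y"
  by (metis dot_lmul_matrix inner_commute)

lemma inner_symmetric_matrix_mult:
  fixes Q :: "real^'n^'n"
  assumes "transpose Q = Q"
  shows "x \<bullet> (Q *v y) = y \<bullet> (Q *v x)"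
  by (metis assms dot_lmul_matrix inner_commute transpose_matrix_vector)

lemma uminus_matrix_vector_mult:
  fixes A :: "real^'n^'m"
  shows "(- A) *v x = - (A *v x)"
  by (simp add: matrix_vector_mult_def vec_eq_iff sum_negf)

lemma sum_matrix_vector_mult:
  fixes Q :: "'i \<Rightarrow> real^'n^'m"
  assumes "finite I"
  shows "(\<Sum>i\<in>I. Q i) *v x = (\<Sum>i\<in>I. Q i *v x)"
  using assms by induction (simp_all add: matrix_vector_mult_add_rdistrib)

lemma transpose_add:
  fixes A B :: "real^'n^'m"
  shows "transpose (A + B) = transpose A + transpose B"
  by (simp add: transpose_def vec_eq_iff)

lemma transpose_diff:
  fixes A B :: "real^'n^'m"
  shows "transpose (A - B) = transpose A - transpose B"
  by (simp add: transpose_def vec_eq_iff)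

lemma transpose_sum:
  fixes Q :: "'i \<Rightarrow> real^'n^'m"
  assumes "finite I"
  shows "transpose (\<Sum>i\<in>I. Q i) = (\<Sum>i\<in>I. transpose (Q i))"
  using assms by induction (simp_all add: transpose_add, simp add: transpose_def vec_eq_iff)

definition sym_possemidef :: "real^'n^'n \<Rightarrow> bool"
  where "sym_possemidef Q \<longleftrightarrow> transpose Q = Q \<and> (\<forall>x. 0 \<le> x \<bullet> (Q *v x))"

lemma sym_posdef_imp_sym_possemidef: "sym_posdef Q \<Longrightarrow> sym_possemidef Q"
  unfolding sym_posdef_def sym_possemidef_def
  by (metis inner_zero_left less_eq_real_def)

lemma quadratic_form_add:
  fixes Q :: "real^'n^'n"
  assumes "transpose Q = Q"
  shows "(x + y) \<bullet> (Q *v (x + y)) = x \<bullet> (Q *v x) + 2 * (x \<bullet> (Q *v y)) + y \<bullet> (Q *v y)"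
  using inner_symmetric_matrix_mult[OF assms, of x y]
  by (simp add: inner_add_left inner_add_right matrix_vector_right_distrib)

text \<open>If \<open>Q x\<close> did not vanish, moving from \<open>x\<close> a little way in the direction \<open>- Q x\<close> would make
  the form negative.\<close>

lemma possemidef_form_zero_imp_kernel:
  assumes Q: "sym_possemidef Q" and zero: "x \<bullet> (Q *v x) = 0"
  shows "Q *v x = 0"
proof (rule ccontr)
  assume "Q *v x \<noteq> 0"
  define y where "y = Q *v x"
  define a where "a = y \<bullet> y"
  define b where "b = y \<bullet> (Q *v y)"
  have sym: "transpose Q = Q" and nonneg: "\<And>v. 0 \<le> v \<bullet> (Q *v v)"
    using Q by (auto simp: sym_possemidef_def)
  have a: "a > 0" and b: "b \<ge> 0"
    using \<open>Q *v x \<noteq> 0\<close> nonneg by (auto simp: a_def b_def y_def)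
  have xQy: "x \<bullet> (Q *v y) = a"
    using inner_symmetric_matrix_mult[OF sym, of x y] by (simp add: a_def y_def)
  \<comment> \<open>The form at \<open>x + t y\<close> is \<open>2 a t + b t\<^sup>2\<close>; the \<open>1\<close> in the denominator covers \<open>b = 0\<close>.\<close>
  define t where "t = - a / (b + 1)"
  have "0 \<le> (x + t *\<^sub>R y) \<bullet> (Q *v (x + t *\<^sub>R y))" by (rule nonneg)
  also have "\<dots> = t * (2 * a + t * b)"
    unfolding quadratic_form_add[OF sym]
    by (simp add: zero matrix_vector_mult_scaleR xQy b_def[symmetric] algebra_simps)
  also have "\<dots> < 0"
  proof (rule mult_neg_pos)
    show "t < 0" using a b by (simp add: t_def)
    have "a * b / (b + 1) \<le> a" using a b by (simp add: field_simps)
    then show "0 < 2 * a + t * b" using a by (simp add: t_def)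
  qed
  finally show False by simp
qed

lemma symmetric_form_zero_imp_zero:
  fixes Q :: "real^'n^'n"
  assumes "transpose Q = Q" and "\<And>x. x \<bullet> (Q *v x) = 0"
  shows "Q = 0"
proof -
  have "Q *v x = 0" for x
    using assms by (intro possemidef_form_zero_imp_kernel) (auto simp: sym_possemidef_def)
  then show ?thesis by (simp add: matrix_eq)
qed

lemma matrix_inv_inverse:
  fixes Q :: "real^'n^'n"
  assumes "invertible Q"
  shows "Q ** matrix_inv Q = mat 1" "matrix_inv Q ** Q = mat 1"
  using someI_ex[OF assms[unfolded invertible_def]] by (simp_all add: matrix_inv_def)

lemma sym_posdef_imp_invertible:
  assumes "sym_posdef Q"
  shows "invertible Q"
proof -
  have "\<forall>x. Q *v x = 0 \<longrightarrow> x = 0"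
    using assms unfolding sym_posdef_def by (metis inner_zero_right less_irrefl)
  then have "\<exists>L. L ** Q = mat 1" using matrix_left_invertible_ker by blast
  then show ?thesis by (simp add: invertible_left_inverse)
qed

lemma matrix_inv_mult_vector:
  fixes Q :: "real^'n^'n"
  assumes "sym_posdef Q"
  shows "Q *v (matrix_inv Q *v x) = x"
  by (simp add: matrix_vector_mul_assoc matrix_inv_inverse sym_posdef_imp_invertible[OF assms])

lemma transpose_matrix_inv:
  fixes Q :: "real^'n^'n"
  assumes "sym_posdef Q"
  shows "transpose (matrix_inv Q) = matrix_inv Q"
proof -
  note inv = matrix_inv_inverse[OF sym_posdef_imp_invertible[OF assms]]
  have "transpose (matrix_inv Q) ** Q = mat 1"
    using arg_cong[OF inv(1), of transpose] assms by (simp add: matrix_transpose_mul sym_posdef_def)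
  then show ?thesis
    by (metis inv(1) matrix_mul_assoc matrix_mul_lid matrix_mul_rid)
qed

section \<open>Limits of matrices\<close>

lemma tendsto_matrix_vector_mult [tendsto_intros]:
  fixes f :: "'a \<Rightarrow> real^'n^'m"
  assumes "(f \<longlongrightarrow> F) net" "(g \<longlongrightarrow> G) net"
  shows "((\<lambda>i. f i *v g i) \<longlongrightarrow> F *v G) net"
  unfolding matrix_vector_mult_def by (intro tendsto_intros assms)

lemma tendsto_matrix_matrix_mult [tendsto_intros]:
  fixes f :: "'a \<Rightarrow> real^'n^'m" and g :: "'a \<Rightarrow> real^'l^'n"
  assumes "(f \<longlongrightarrow> F) net" "(g \<longlongrightarrow> G) net"
  shows "((\<lambda>i. f i ** g i) \<longlongrightarrow> F ** G) net"
  unfolding matrix_matrix_mult_def by (intro tendsto_intros assms)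

lemma tendsto_transpose [tendsto_intros]:
  fixes f :: "'a \<Rightarrow> real^'n^'m"
  assumes "(f \<longlongrightarrow> F) net"
  shows "((\<lambda>i. transpose (f i)) \<longlongrightarrow> transpose F) net"
  unfolding transpose_def by (intro tendsto_intros assms)

lemma tendsto_det [tendsto_intros]:
  fixes f :: "'a \<Rightarrow> real^'n^'n"
  assumes "(f \<longlongrightarrow> F) net"
  shows "((\<lambda>i. det (f i)) \<longlongrightarrow> det F) net"
  unfolding det_def by (intro tendsto_intros assms)

text \<open>Cramer's rule expresses the entries of the inverse as quotients of determinants.\<close>

lemma tendsto_matrix_inv:
  fixes f :: "'a \<Rightarrow> real^'n^'n"
  assumes f: "(f \<longlongrightarrow> F) net" and F: "invertible F"
  shows "((\<lambda>i. matrix_inv (f i)) \<longlongrightarrow> matrix_inv F) net"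
proof (intro vec_tendstoI)
  fix a b
  define q where "q = (\<lambda>G :: real^'n^'n.
    det (\<chi> i j. if j = a then axis b 1 $ i else G $ i $ j) / det G)"
  have entry: "matrix_inv G $ a $ b = q G" if "det G \<noteq> 0" for G :: "real^'n^'n"
  proof -
    have "invertible G" using that by (simp add: invertible_det_nz)
    then have "G *v (matrix_inv G *v axis b 1) = axis b 1"
      by (simp add: matrix_vector_mul_assoc matrix_inv_inverse)
    then have "(matrix_inv G *v axis b 1) $ a = q G"
      by (simp add: cramer[OF that] q_def)
    then show ?thesis by (simp add: matrix_vector_mult_basis column_def)
  qed
  have det: "det F \<noteq> 0" using F by (simp add: invertible_det_nz)
  have "((\<lambda>i. q (f i)) \<longlongrightarrow> q F) net"
    unfolding q_def
  proof (intro tendsto_intros f det)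
    fix i j
    show "((\<lambda>x. if j = a then axis b 1 $ i else f x $ i $ j) \<longlongrightarrow>
      (if j = a then axis b 1 $ i else F $ i $ j)) net"
      by (cases "j = a") (auto intro!: tendsto_intros f)
  qed
  moreover have "\<forall>\<^sub>F i in net. det (f i) \<noteq> 0"
    by (intro tendsto_imp_eventually_ne[OF tendsto_det[OF f] det])
  then have "\<forall>\<^sub>F i in net. q (f i) = matrix_inv (f i) $ a $ b"
    by eventually_elim (simp add: entry)
  ultimately show "((\<lambda>i. matrix_inv (f i) $ a $ b) \<longlongrightarrow> matrix_inv F $ a $ b) net"
    unfolding entry[OF det] by (blast intro: Lim_transform_eventually)
qed

text \<open>Each quadratic form decreases to a limit, and by polarization the forms determine the
  entries.\<close>

lemma decreasing_possemidef_convergent: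
  fixes Q :: "nat \<Rightarrow> real^'n^'n"
  assumes Q: "\<And>i. sym_possemidef (Q i)"
    and mono: "\<And>i x. x \<bullet> (Q (Suc i) *v x) \<le> x \<bullet> (Q i *v x)"
  obtains L where "Q \<longlonglongrightarrow> L" "sym_possemidef L"
proof -
  have sym: "\<And>i. transpose (Q i) = Q i" and nonneg: "\<And>i x. 0 \<le> x \<bullet> (Q i *v x)"
    using Q by (auto simp: sym_possemidef_def)
  have form_conv: "convergent (\<lambda>i. x \<bullet> (Q i *v x))" for x
  proof -
    have "decseq (\<lambda>i. x \<bullet> (Q i *v x))" by (simp add: decseq_Suc_iff mono)
    from decseq_convergent[OF this, of 0] nonneg show ?thesis
      by (metis convergent_def)
  qed
  have "convergent (\<lambda>i. Q i $ a $ b)" for a b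
  proof -
    have "Q i $ a $ b =
      ((axis a 1 + axis b 1) \<bullet> (Q i *v (axis a 1 + axis b 1))
        - axis a 1 \<bullet> (Q i *v axis a 1) - axis b 1 \<bullet> (Q i *v axis b 1)) / 2" for i
      by (simp add: quadratic_form_add[OF sym] matrix_vector_mult_basis column_def
          inner_axis' )
    then show ?thesis
      by (simp only: divide_inverse)
        (intro convergent_diff convergent_mult form_conv convergent_const)
  qed
  then have "\<forall>a b. \<exists>l. (\<lambda>i. Q i $ a $ b) \<longlonglongrightarrow> l" by (simp add: convergent_def)
  then obtain l where l: "\<And>a b. (\<lambda>i. Q i $ a $ b) \<longlonglongrightarrow> l a b" by metis
  define L where "L = (\<chi> a b. l a b)"
  have lim: "Q \<longlonglongrightarrow> L"
    by (intro vec_tendstoI) (simp add: L_def l)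
  have "transpose L = L"
    using LIMSEQ_unique[OF tendsto_transpose[OF lim]] lim by (simp add: sym)
  moreover have "0 \<le> x \<bullet> (L *v x)" for x
  proof (rule LIMSEQ_le_const)
    show "(\<lambda>i. x \<bullet> (Q i *v x)) \<longlonglongrightarrow> x \<bullet> (L *v x)" by (intro tendsto_intros lim)
  qed (use nonneg in auto)
  ultimately show thesis using that lim by (simp add: sym_possemidef_def)
qed

section \<open>A comparison principle for coupled Lyapunov inequalities\<close>

text \<open>The infinitesimal generator of the pair of \<open>dX = A(\<alpha>) X ds + C(\<alpha>) X dW\<close> and the chain
  with generator \<open>\<pi>\<close>, applied to the function sending \<open>(x, k)\<close> to \<open>x \<bullet> P\<^sub>k x\<close>.\<close>

definition generator_form ::
    "('k::finite \<Rightarrow> 'k \<Rightarrow> real) \<Rightarrow> ('k \<Rightarrow> real^'n^'n) \<Rightarrow> ('k \<Rightarrow> real^'n^'n) \<Rightarrow>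
     ('k \<Rightarrow> real^'n^'n) \<Rightarrow> 'k \<Rightarrow> real^'n \<Rightarrow> real"
  where "generator_form \<pi> A C P k x =
    2 * ((A k *v x) \<bullet> (P k *v x)) + (C k *v x) \<bullet> (P k *v (C k *v x))
    + (\<Sum>j\<in>UNIV. \<pi> k j * (x \<bullet> (P j *v x)))"

lemma generator_form_diff:
  "generator_form \<pi> A C (\<lambda>k. P k - Q k) k x = generator_form \<pi> A C P k x - generator_form \<pi> A C Q k x"
  by (simp add: generator_form_def matrix_vector_mult_diff_rdistrib inner_diff_right
      right_diff_distrib sum_subtractf)

lemma generator_form_scaleR:
  "generator_form \<pi> A C (\<lambda>k. c *\<^sub>R P k) k x = c * generator_form \<pi> A C P k x"
  by (simp add: generator_form_def scaleR_matrix_vector_assoc[symmetric] sum_distrib_left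
      algebra_simps)

text \<open>The maximum principle for the generator: \<open>(x, k)\<close> is a minimum of \<open>(y, j) \<mapsto> y \<bullet> P\<^sub>j y\<close>, so
  the drift term vanishes there, diffusion cannot lower the value, and neither can a jump to
  another mode.\<close>

lemma generator_form_nonneg_at_zero:
  assumes rates: "\<And>j. k \<noteq> j \<Longrightarrow> 0 \<le> \<pi> k j"
    and P: "\<And>j. sym_possemidef (P j)" and zero: "x \<bullet> (P k *v x) = 0"
  shows "0 \<le> generator_form \<pi> A C P k x"
proof -
  have "P k *v x = 0" using P zero by (rule possemidef_form_zero_imp_kernel)
  moreover have "0 \<le> \<pi> k j * (x \<bullet> (P j *v x))" for j
    using rates[of j] P[of j] zero by (cases "k = j") (auto simp: sym_possemidef_def)
  moreover have "0 \<le> (C k *v x) \<bullet> (P k *v (C k *v x))"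
    using P[of k] by (simp add: sym_possemidef_def)
  ultimately show ?thesis by (simp add: generator_form_def sum_nonneg)
qed

text \<open>The ratio of the two forms is homogeneous of degree \<open>0\<close>, so its supremum is attained on the
  unit sphere, in one of finitely many modes.\<close>

lemma max_form_ratio:
  fixes H P :: "'k::finite \<Rightarrow> real^'n^'n"
  assumes P: "\<And>k. sym_posdef (P k)"
  obtains k x c where "x \<noteq> 0" "x \<bullet> (H k *v x) = c * (x \<bullet> (P k *v x))"
    "\<And>j y. y \<bullet> (H j *v y) \<le> c * (y \<bullet> (P j *v y))"
proof -
  define f where "f = (\<lambda>k x. (x \<bullet> (H k *v x)) / (x \<bullet> (P k *v x)))"
  have pos: "0 < x \<bullet> (P k *v x)" if "x \<noteq> 0" for k x
    using P[of k] that by (simp add: sym_posdef_def)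
  have "\<exists>x\<in>sphere 0 1. \<forall>y\<in>sphere 0 1. f k y \<le> f k x" for k
  proof (rule continuous_attains_sup)
    show "continuous_on (sphere 0 1) (f k)"
      unfolding f_def
      by (intro continuous_intros linear_continuous_on matrix_vector_mul_bounded_linear)
         (metis pos mem_sphere_0 norm_zero zero_neq_one less_irrefl)
  qed auto
  then obtain z where z: "\<And>k. z k \<in> sphere 0 1" "\<And>k y. y \<in> sphere 0 1 \<Longrightarrow> f k y \<le> f k (z k)"
    by metis
  have "Max (range (\<lambda>k. f k (z k))) \<in> range (\<lambda>k. f k (z k))" by (intro Max_in) auto
  then obtain k where k: "Max (range (\<lambda>k. f k (z k))) = f k (z k)" by (rule rangeE)
  have max: "f j (z j) \<le> f k (z k)" for j
    unfolding k[symmetric] by (intro Max_ge) auto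
  show thesis
  proof (rule that[of "z k" k "f k (z k)"])
    show nz: "z k \<noteq> 0" using z(1)[of k] by auto
    show "z k \<bullet> (H k *v z k) = f k (z k) * (z k \<bullet> (P k *v z k))"
      using pos[OF nz, of k] by (simp add: f_def)
    fix j y
    show "y \<bullet> (H j *v y) \<le> f k (z k) * (y \<bullet> (P j *v y))"
    proof (cases "y = 0")
      case False
      define s where "s = (1 / norm y) *\<^sub>R y"
      have "f j y = f j s"
        using False by (simp add: f_def s_def matrix_vector_mult_scaleR)
      also have "\<dots> \<le> f k (z k)"
        using z(2)[of s j] max[of j] False by (simp add: s_def)
      finally show ?thesis
        using pos[OF False, of j] by (simp add: f_def field_simps)
    qed simp
  qed
qed

text \<open>With \<open>c\<close> the largest ratio of \<open>H\<close> to \<open>P\<close>, the tuple \<open>c P - H\<close> is positive semidefinite and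
  its form vanishes somewhere off \<open>0\<close>. There its generator is nonnegative by the maximum principle,
  and at most \<open>c\<close> times a negative number by hypothesis, which forces \<open>c \<le> 0\<close>.\<close>

lemma generator_form_comparison:
  fixes P H :: "'k::finite \<Rightarrow> real^'n^'n"
  assumes rates: "\<And>k j. k \<noteq> j \<Longrightarrow> 0 \<le> \<pi> k j"
    and P: "\<And>k. sym_posdef (P k)"
    and P_neg: "\<And>k x. x \<noteq> 0 \<Longrightarrow> generator_form \<pi> A C P k x < 0"
    and H: "\<And>k. transpose (H k) = H k"
    and H_nonneg: "\<And>k x. 0 \<le> generator_form \<pi> A C H k x"
  shows "x \<bullet> (H k *v x) \<le> 0"
proof -
  obtain j z c where z: "z \<noteq> 0" "z \<bullet> (H j *v z) = c * (z \<bullet> (P j *v z))"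
    and max: "\<And>i y. y \<bullet> (H i *v y) \<le> c * (y \<bullet> (P i *v y))"
    using max_form_ratio[of P H, OF P] by metis
  define Q where "Q = (\<lambda>k. c *\<^sub>R P k - H k)"
  have form: "y \<bullet> (Q i *v y) = c * (y \<bullet> (P i *v y)) - y \<bullet> (H i *v y)" for i y
    by (simp add: Q_def matrix_vector_mult_diff_rdistrib scaleR_matrix_vector_assoc[symmetric]
        inner_diff_right)
  have "0 \<le> generator_form \<pi> A C Q j z"
  proof (rule generator_form_nonneg_at_zero[OF rates])
    show "sym_possemidef (Q i)" for i
      using P[of i] H[of i] max[of _ i]
      by (simp add: sym_possemidef_def form) (simp add: Q_def transpose_diff transpose_scalar sym_posdef_def)
  qed (simp_all add: form z)
  also have "generator_form \<pi> A C Q j z = c * generator_form \<pi> A C P j z - generator_form \<pi> A C H j z"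
    by (simp add: Q_def generator_form_diff generator_form_scaleR)
  finally have "0 \<le> c * generator_form \<pi> A C P j z"
    using H_nonneg[of j z] by simp
  then have "c \<le> 0"
    using P_neg[OF z(1), of j] by (metis mult_pos_neg not_le)
  moreover have "0 \<le> x \<bullet> (P k *v x)"
    using sym_posdef_imp_sym_possemidef[OF P, of k] by (simp add: sym_possemidef_def)
  ultimately show ?thesis
    using max[of x k] by (meson mult_nonpos_nonneg order_trans)
qed

section \<open>Policy iteration as minimization of a quadratic Hamiltonian\<close>

locale jump_lq =
  fixes A C N :: "'k::finite \<Rightarrow> real^'n^'n"
    and B D :: "'k \<Rightarrow> real^'r^'n"
    and R :: "'k \<Rightarrow> real^'r^'r"
    and S :: "'k \<Rightarrow> real^'n^'r"
    and \<pi> :: "'k \<Rightarrow> 'k \<Rightarrow> real"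
  assumes rates: "k \<noteq> j \<Longrightarrow> 0 \<le> \<pi> k j"
    and N_sym: "transpose (N k) = N k"
    and R_posdef: "sym_posdef (R k)"
    and schur_posdef: "sym_posdef (N k - transpose (S k) ** matrix_inv (R k) ** S k)"
begin

definition running_cost :: "'k \<Rightarrow> real^'n \<Rightarrow> real^'r \<Rightarrow> real"
  where "running_cost k x u = u \<bullet> (R k *v u) + 2 * (u \<bullet> (S k *v x)) + x \<bullet> (N k *v x)"

definition hamiltonian :: "('k \<Rightarrow> real^'n^'n) \<Rightarrow> 'k \<Rightarrow> real^'n \<Rightarrow> real^'r \<Rightarrow> real"
  where "hamiltonian P k x u =
    2 * ((A k *v x + B k *v u) \<bullet> (P k *v x))
    + (C k *v x + D k *v u) \<bullet> (P k *v (C k *v x + D k *v u))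
    + (\<Sum>j\<in>UNIV. \<pi> k j * (x \<bullet> (P j *v x))) + running_cost k x u"

abbreviation closed_loop_form :: "('k \<Rightarrow> real^'n^'r) \<Rightarrow> ('k \<Rightarrow> real^'n^'n) \<Rightarrow> 'k \<Rightarrow> real^'n \<Rightarrow> real"
  where "closed_loop_form K \<equiv> generator_form \<pi> (\<lambda>k. A k + B k ** K k) (\<lambda>k. C k + D k ** K k)"

abbreviation input_weight :: "('k \<Rightarrow> real^'n^'n) \<Rightarrow> 'k \<Rightarrow> real^'r^'r"
  where "input_weight P k \<equiv> R k + transpose (D k) ** P k ** D k"

abbreviation cross_weight :: "('k \<Rightarrow> real^'n^'n) \<Rightarrow> 'k \<Rightarrow> real^'n^'r"
  where "cross_weight P k \<equiv> transpose (B k) ** P k + transpose (D k) ** P k ** C k + S k"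

abbreviation greedy :: "('k \<Rightarrow> real^'n^'n) \<Rightarrow> 'k \<Rightarrow> real^'n^'r"
  where "greedy \<equiv> gain B C D R S"

lemma hamiltonian_feedback:
  "hamiltonian P k x (K k *v x) = closed_loop_form K P k x + running_cost k x (K k *v x)"
  by (simp add: hamiltonian_def generator_form_def matrix_vector_mult_add_rdistrib
      matrix_vector_mul_assoc[symmetric])

text \<open>Completing the square in \<open>u\<close> leaves the form of the Schur complement
  \<open>N - S\<^sup>T R\<^sup>-\<^sup>1 S\<close> at \<open>x\<close>.\<close>

lemma running_cost_pos:
  assumes "x \<noteq> 0"
  shows "0 < running_cost k x u"
proof -
  define v where "v = matrix_inv (R k) *v (S k *v x)"
  have R_sym: "transpose (R k) = R k" using R_posdef by (simp add: sym_posdef_def)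
  have Rv: "R k *v v = S k *v x"
    unfolding v_def by (rule matrix_inv_mult_vector[OF R_posdef])
  have "0 < x \<bullet> ((N k - transpose (S k) ** matrix_inv (R k) ** S k) *v x)"
    using schur_posdef[of k] assms by (simp add: sym_posdef_def)
  also have "\<dots> = x \<bullet> (N k *v x) - v \<bullet> (R k *v v)"
    by (simp add: matrix_vector_mult_diff_rdistrib matrix_vector_mul_assoc[symmetric] Rv
        inner_diff_right inner_vector_matrix_mult v_def[symmetric] inner_commute)
  also have "\<dots> \<le> x \<bullet> (N k *v x) - v \<bullet> (R k *v v) + (u + v) \<bullet> (R k *v (u + v))"
    using sym_posdef_imp_sym_possemidef[OF R_posdef[of k]] by (simp add: sym_possemidef_def)
  also have "\<dots> = running_cost k x u"
    unfolding quadratic_form_add[OF R_sym] by (simp add: running_cost_def Rv)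
  finally show ?thesis .
qed

lemma input_weight_posdef:
  assumes "sym_possemidef (P k)"
  shows "sym_posdef (input_weight P k)"
proof -
  have "transpose (input_weight P k) = input_weight P k"
    using assms R_posdef[of k]
    by (simp add: transpose_add matrix_transpose_mul matrix_mul_assoc sym_posdef_def sym_possemidef_def)
  moreover have "0 < u \<bullet> (input_weight P k *v u)" if "u \<noteq> 0" for u
  proof -
    have "u \<bullet> (input_weight P k *v u) = u \<bullet> (R k *v u) + (D k *v u) \<bullet> (P k *v (D k *v u))"
      by (simp add: matrix_vector_mult_add_rdistrib matrix_vector_mul_assoc[symmetric]
          inner_add_right inner_vector_matrix_mult)
    then show ?thesis
      using assms R_posdef[of k] that
      by (simp add: sym_possemidef_def sym_posdef_def add_pos_nonneg)
  qed
  ultimately show ?thesis by (simp add: sym_posdef_def)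
qed

lemma hamiltonian_quadratic:
  assumes "transpose (P k) = P k"
  shows "hamiltonian P k x u =
    hamiltonian P k x 0 + 2 * (u \<bullet> (cross_weight P k *v x)) + u \<bullet> (input_weight P k *v u)"
  using inner_symmetric_matrix_mult[OF assms, of "C k *v x" "D k *v u"]
  by (simp add: hamiltonian_def running_cost_def matrix_vector_mult_add_rdistrib
      matrix_vector_mul_assoc[symmetric] matrix_vector_right_distrib
      inner_add_right inner_add_left inner_vector_matrix_mult)

lemma input_weight_greedy:
  assumes "sym_possemidef (P k)"
  shows "input_weight P k *v (greedy P k *v x) = - (cross_weight P k *v x)"
proof -
  have "greedy P k *v x = - (matrix_inv (input_weight P k) *v (cross_weight P k *v x))"
    by (simp add: gain_def uminus_matrix_vector_mult matrix_vector_mul_assoc)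
  then show ?thesis
    using matrix_inv_mult_vector[OF input_weight_posdef[of P k, OF assms], of "cross_weight P k *v x"]
    by (simp add: matrix_vector_mult_diff_distrib[of _ 0, simplified])
qed

lemma hamiltonian_complete_square:
  assumes P: "sym_possemidef (P k)"
    and g_def: "g = greedy P k *v x"
  shows "hamiltonian P k x u =
    hamiltonian P k x g + (u - g) \<bullet> (input_weight P k *v (u - g))"
proof -
  let ?G = "input_weight P k"
  have P_sym: "transpose (P k) = P k" using P by (simp add: sym_possemidef_def)
  have G_sym: "transpose ?G = ?G"
    using input_weight_posdef[of P k, OF P] by (simp add: sym_posdef_def)
  have cross: "cross_weight P k *v x = - (?G *v g)"
    unfolding g_def input_weight_greedy[of P k, OF P] by simp
  show ?thesis
    using inner_symmetric_matrix_mult[OF G_sym, of g u]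
    unfolding hamiltonian_quadratic[of P k x u, OF P_sym] hamiltonian_quadratic[of P k x g, OF P_sym] cross
    by (simp only: matrix_vector_mult_diff_distrib inner_diff_left inner_diff_right inner_minus_right)
qed

lemma hamiltonian_greedy_le:
  assumes "sym_possemidef (P k)"
  shows "hamiltonian P k x (greedy P k *v x) \<le> hamiltonian P k x u"
  unfolding hamiltonian_complete_square[of P k _ x u, OF assms refl]
  using sym_posdef_imp_sym_possemidef[OF input_weight_posdef[of P k, OF assms]]
  by (simp add: sym_possemidef_def)

lemma lyapunov_imp_hamiltonian_zero:
  assumes P: "transpose (P k) = P k" and lyap: "solves_lyapunov A B C D \<pi> N R S K P"
  shows "hamiltonian P k x (K k *v x) = 0"
proof -
  let ?A = "A k + B k ** K k" and ?C = "C k + D k ** K k"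
  have "0 = x \<bullet> ((transpose ?A ** P k + P k ** ?A + transpose ?C ** P k ** ?C
    + (\<Sum>j\<in>UNIV. \<pi> k j *\<^sub>R P j) + transpose (K k) ** R k ** K k
    + transpose (S k) ** K k + transpose (K k) ** S k + N k) *v x)"
    using lyap unfolding solves_lyapunov_def by simp
  also have "\<dots> = (?A *v x) \<bullet> (P k *v x) + x \<bullet> (P k *v (?A *v x)) + (?C *v x) \<bullet> (P k *v (?C *v x))
    + (\<Sum>j\<in>UNIV. \<pi> k j * (x \<bullet> (P j *v x))) + (K k *v x) \<bullet> (R k *v (K k *v x))
    + (S k *v x) \<bullet> (K k *v x) + (K k *v x) \<bullet> (S k *v x) + x \<bullet> (N k *v x)"
    by (simp only: matrix_vector_mult_add_rdistrib[of _ _ x] matrix_vector_mul_assoc[symmetric]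
        inner_add_right transpose_matrix_vector inner_vector_matrix_mult sum_matrix_vector_mult
        finite scaleR_matrix_vector_assoc[symmetric] inner_sum_right inner_scaleR_right)
  also have "\<dots> = hamiltonian P k x (K k *v x)"
    unfolding hamiltonian_feedback generator_form_def running_cost_def
    using inner_symmetric_matrix_mult[OF P, of x "?A *v x"] by (simp add: inner_commute)
  finally show ?thesis by simp
qed

lemma riccati_iff_hamiltonian_zero:
  assumes P: "\<And>k. sym_possemidef (P k)"
  shows "solves_riccati A B C D \<pi> N R S P \<longleftrightarrow> (\<forall>k x. hamiltonian P k x (greedy P k *v x) = 0)"
proof -
  define E where "E = (\<lambda>k. transpose (A k) ** P k + P k ** A k + transpose (C k) ** P k ** C k + N k
    + (\<Sum>j\<in>UNIV. \<pi> k j *\<^sub>R P j)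
    - (P k ** B k + transpose (C k) ** P k ** D k + transpose (S k))
      ** matrix_inv (input_weight P k) ** cross_weight P k)"
  have P_sym: "transpose (P k) = P k" for k using P by (simp add: sym_possemidef_def)
  have cross_transpose: "P k ** B k + transpose (C k) ** P k ** D k + transpose (S k)
    = transpose (cross_weight P k)" for k
    by (simp add: transpose_add matrix_transpose_mul matrix_mul_assoc P_sym)
  have E_sym: "transpose (E k) = E k" for k
    unfolding E_def cross_transpose
    using transpose_matrix_inv[OF input_weight_posdef[of P k, OF P]]
    by (simp add: transpose_add transpose_diff matrix_transpose_mul matrix_mul_assoc P_sym N_sym
        transpose_sum transpose_scalar add.commute)
  have form: "x \<bullet> (E k *v x) = hamiltonian P k x (greedy P k *v x)" for k x
  proof -
    let ?G = "input_weight P k" and ?Z = "cross_weight P k *v x"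
    define g where "g = greedy P k *v x"
    have g: "g = - (matrix_inv ?G *v ?Z)"
      by (simp add: g_def gain_def uminus_matrix_vector_mult matrix_vector_mul_assoc)
    have "x \<bullet> (E k *v x) = (A k *v x) \<bullet> (P k *v x) + x \<bullet> (P k *v (A k *v x))
      + (C k *v x) \<bullet> (P k *v (C k *v x)) + x \<bullet> (N k *v x)
      + (\<Sum>j\<in>UNIV. \<pi> k j * (x \<bullet> (P j *v x))) - ?Z \<bullet> (matrix_inv ?G *v ?Z)"
      unfolding E_def cross_transpose
      by (simp only: matrix_vector_mult_diff_rdistrib matrix_vector_mult_add_rdistrib[of _ _ x] matrix_vector_mul_assoc[symmetric]
        inner_add_right inner_diff_right transpose_matrix_vector inner_vector_matrix_mult sum_matrix_vector_mult
        finite scaleR_matrix_vector_assoc[symmetric] inner_sum_right inner_scaleR_right)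
    also have "\<dots> = hamiltonian P k x 0 + ?Z \<bullet> g"
      unfolding g hamiltonian_def running_cost_def
      using inner_symmetric_matrix_mult[OF P_sym[of k], of x "A k *v x"] by simp
    also have "\<dots> = hamiltonian P k x g"
      using hamiltonian_quadratic[of P k x g, OF P_sym] input_weight_greedy[of P k x, OF P]
      by (simp only: g_def[symmetric] inner_commute[of ?Z] inner_minus_right)
    finally show ?thesis by (simp add: g_def)
  qed
  have "solves_riccati A B C D \<pi> N R S P \<longleftrightarrow> (\<forall>k. E k = 0)"
    by (simp add: solves_riccati_def E_def)
  also have "\<dots> \<longleftrightarrow> (\<forall>k x. x \<bullet> (E k *v x) = 0)"
    using symmetric_form_zero_imp_zero[OF E_sym] by auto
  finally show ?thesis by (simp add: form)
qed

text \<open>Here \<open>P\<close> serves as the strict Lyapunov function of the feedback \<open>K\<close>. The running costs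
  cancel in the difference of the two Hamiltonians, which leaves the generator of \<open>Y - X\<close>.\<close>

lemma hamiltonian_comparison:
  assumes P: "\<And>k. sym_posdef (P k)"
    and P_zero: "\<And>k x. hamiltonian P k x (K k *v x) = 0"
    and X: "\<And>k. sym_possemidef (X k)" and Y: "\<And>k. sym_possemidef (Y k)"
    and le: "\<And>k x. hamiltonian X k x (K k *v x) \<le> hamiltonian Y k x (K k *v x)"
  shows "x \<bullet> (Y k *v x) \<le> x \<bullet> (X k *v x)"
proof -
  have "x \<bullet> ((Y k - X k) *v x) \<le> 0"
  proof (rule generator_form_comparison[where H = "\<lambda>k. Y k - X k", OF rates P])
    show "closed_loop_form K P j y < 0" if "y \<noteq> 0" for j y
      using P_zero[of j y] running_cost_pos[OF that, of j "K j *v y"]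
      by (simp add: hamiltonian_feedback)
    show "0 \<le> closed_loop_form K (\<lambda>k. Y k - X k) j y" for j y
      using le[of j y] by (simp add: hamiltonian_feedback generator_form_diff)
    show "transpose (Y j - X j) = Y j - X j" for j
      using X[of j] Y[of j] by (simp add: transpose_diff sym_possemidef_def)
  qed
  then show ?thesis by (simp add: matrix_vector_mult_diff_rdistrib inner_diff_right)
qed

text \<open>At a nonzero null direction of \<open>P\<close> the generator would be nonnegative by the maximum
  principle, while the equation makes it equal to minus a positive running cost.\<close>

lemma evaluation_posdef:
  assumes P: "\<And>k. sym_possemidef (P k)"
    and zero: "\<And>k x. hamiltonian P k x (K k *v x) = 0"
  shows "sym_posdef (P k)"
proof -
  have "0 < x \<bullet> (P k *v x)" if "x \<noteq> 0" for x
  proof (rule ccontr)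
    assume "\<not> 0 < x \<bullet> (P k *v x)"
    then have "x \<bullet> (P k *v x) = 0"
      using P[of k] by (metis sym_possemidef_def less_eq_real_def)
    then have "0 \<le> closed_loop_form K P k x"
      by (intro generator_form_nonneg_at_zero rates P)
    then show False
      using zero[of k x] running_cost_pos[OF that, of k "K k *v x"]
      by (simp add: hamiltonian_feedback)
  qed
  then show ?thesis using P[of k] by (simp add: sym_posdef_def sym_possemidef_def)
qed

text \<open>Under the feedback that is optimal for \<open>P\<close>, the Hamiltonian of \<open>P\<close> is \<open>0\<close> and that of \<open>Q\<close>
  is at least its minimum \<open>0\<close>.\<close>

lemma riccati_le:
  assumes P: "\<And>k. sym_posdef (P k)" "solves_riccati A B C D \<pi> N R S P"
    and Q: "\<And>k. sym_posdef (Q k)" "solves_riccati A B C D \<pi> N R S Q"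
  shows "x \<bullet> (Q k *v x) \<le> x \<bullet> (P k *v x)"
proof -
  have psd: "sym_possemidef (P j)" "sym_possemidef (Q j)" for j
    using P Q by (auto intro: sym_posdef_imp_sym_possemidef)
  have P_zero: "hamiltonian P j y (greedy P j *v y) = 0"
    and Q_zero: "hamiltonian Q j y (greedy Q j *v y) = 0" for j y
    using P(2) Q(2) psd riccati_iff_hamiltonian_zero by blast+
  show ?thesis
  proof (rule hamiltonian_comparison[OF P(1) P_zero psd])
    show "hamiltonian P j y (greedy P j *v y) \<le> hamiltonian Q j y (greedy P j *v y)" for j y
      using hamiltonian_greedy_le[of Q j y "greedy P j *v y", OF psd(2)] by (simp add: P_zero Q_zero)
  qed
qed

lemma riccati_unique:
  assumes "\<And>k. sym_posdef (P k)" "solves_riccati A B C D \<pi> N R S P"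
    and "\<And>k. sym_posdef (Q k)" "solves_riccati A B C D \<pi> N R S Q"
  shows "Q = P"
proof
  fix k
  have "Q k - P k = 0"
  proof (rule symmetric_form_zero_imp_zero)
    show "transpose (Q k - P k) = Q k - P k"
      using assms(1,3) by (simp add: transpose_diff sym_posdef_def)
    show "x \<bullet> ((Q k - P k) *v x) = 0" for x
      using riccati_le[OF assms, of x k] riccati_le[OF assms(3,4,1,2), of x k]
      by (simp add: matrix_vector_mult_diff_rdistrib inner_diff_right)
  qed
  then show "Q k = P k" by simp
qed

lemma tendsto_greedy:
  assumes lim: "((\<lambda>i. P i k) \<longlongrightarrow> L k) net" and L: "sym_possemidef (L k)"
  shows "((\<lambda>i. greedy (P i) k) \<longlongrightarrow> greedy L k) net"
  unfolding gain_def
  by (intro tendsto_intros tendsto_matrix_inv lim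
      sym_posdef_imp_invertible input_weight_posdef L)

lemma tendsto_hamiltonian:
  assumes "\<And>k. ((\<lambda>i. P i k) \<longlongrightarrow> L k) net" and "(u \<longlongrightarrow> v) net"
  shows "((\<lambda>i. hamiltonian (P i) k x (u i)) \<longlongrightarrow> hamiltonian L k x v) net"
  unfolding hamiltonian_def running_cost_def by (intro tendsto_intros assms)

text \<open>\<open>P i\<close> evaluates the feedback \<open>K i\<close>, so the index of \<open>P\<close> here lags by one behind an
  enumeration in which evaluating \<open>K i\<close> yields \<open>P (Suc i)\<close>.\<close>

lemma policy_iteration_converges:
  fixes K :: "nat \<Rightarrow> 'k \<Rightarrow> real^'n^'r" and P :: "nat \<Rightarrow> 'k \<Rightarrow> real^'n^'n"
  assumes P: "\<And>i k. sym_posdef (P i k)"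
    and eval: "\<And>i k x. hamiltonian (P i) k x (K i k *v x) = 0"
    and improve: "\<And>i. K (Suc i) = greedy (P i)"
  obtains L where "\<And>k. sym_posdef (L k)" "solves_riccati A B C D \<pi> N R S L"
    "\<And>k. (\<lambda>i. P i k) \<longlonglongrightarrow> L k"
proof -
  have psd: "sym_possemidef (P i k)" for i k
    using P by (rule sym_posdef_imp_sym_possemidef)
  have decreasing: "x \<bullet> (P (Suc i) k *v x) \<le> x \<bullet> (P i k *v x)" for i k x
  proof (rule hamiltonian_comparison[OF P eval psd psd])
    show "hamiltonian (P i) j y (K (Suc i) j *v y)
      \<le> hamiltonian (P (Suc i)) j y (K (Suc i) j *v y)" for j y
      using hamiltonian_greedy_le[of "P i" j y "K i j *v y", OF psd]
        eval[of i] eval[of "Suc i"]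
      by (simp add: improve)
  qed
  have "\<exists>L. (\<lambda>i. P i k) \<longlonglongrightarrow> L \<and> sym_possemidef L" for k
    using decreasing_possemidef_convergent[of "\<lambda>i. P i k"] psd decreasing by metis
  then obtain L where lim: "\<And>k. (\<lambda>i. P i k) \<longlonglongrightarrow> L k" and L_psd: "\<And>k. sym_possemidef (L k)"
    by metis
  \<comment> \<open>Pass to the limit in the evaluation equation of the feedback that is greedy for the
    preceding iterate.\<close>
  have L_zero: "hamiltonian L k x (greedy L k *v x) = 0" for k x
  proof -
    have "(\<lambda>i. hamiltonian (P (Suc i)) k x (greedy (P i) k *v x))
        \<longlonglongrightarrow> hamiltonian L k x (greedy L k *v x)"
      by (intro tendsto_hamiltonian LIMSEQ_Suc[OF lim] tendsto_matrix_vector_mult tendsto_const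
          tendsto_greedy[OF lim L_psd])
    moreover have "hamiltonian (P (Suc i)) k x (greedy (P i) k *v x) = 0" for i
      using eval[of "Suc i"] by (simp add: improve)
    ultimately show ?thesis by (simp add: LIMSEQ_const_iff)
  qed
  show thesis
  proof (rule that[OF _ _ lim])
    show "sym_posdef (L k)" for k by (rule evaluation_posdef[OF L_psd L_zero])
    show "solves_riccati A B C D \<pi> N R S L"
      by (simp add: riccati_iff_hamiltonian_zero L_psd L_zero)
  qed
qed

end

section \<open>Convergence of policy iteration\<close>

theorem theorem3p2:
  fixes M :: "'w measure"
    and W :: "real \<Rightarrow> 'w \<Rightarrow> real"
    and \<alpha> :: "real \<Rightarrow> 'k::finite \<Rightarrow> real \<Rightarrow> 'w \<Rightarrow> 'k"
    and \<pi> :: "'k \<Rightarrow> 'k \<Rightarrow> real"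
    and A C N :: "'k \<Rightarrow> real^'n^'n"
    and B D :: "'k \<Rightarrow> real^'r^'n"
    and R :: "'k \<Rightarrow> real^'r^'r"
    and S :: "'k \<Rightarrow> real^'n^'r"
    and K :: "nat \<Rightarrow> 'k \<Rightarrow> real^'n^'r"
    and P :: "nat \<Rightarrow> 'k \<Rightarrow> real^'n^'n"
  assumes "CARD('k) > 1"
    and "generator_matrix \<pi>"
    and "prob_space M"
    and "brownian_motion M W"
    and "switching_chains M W \<pi> \<alpha>"
    and "\<And>k. transpose (N k) = N k"
    and "\<And>k. sym_posdef (R k)"
    and "\<And>k. sym_posdef (N k - transpose (S k) ** matrix_inv (R k) ** S k)"
    and "stabilizer M W \<alpha> A B C D (K 0)"
    and "\<And>i k. sym_posdef (P (Suc i) k)"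
    and "\<And>i. solves_lyapunov A B C D \<pi> N R S (K i) (P (Suc i))"
    and "\<And>i. K (Suc i) = gain B C D R S (P (Suc i))"
  shows "\<exists>P_inf.
    (\<forall>k. sym_posdef (P_inf k)) \<and> solves_riccati A B C D \<pi> N R S P_inf \<and>
    (\<forall>Q. (\<forall>k. sym_posdef (Q k)) \<and> solves_riccati A B C D \<pi> N R S Q \<longrightarrow> Q = P_inf) \<and>
    (\<forall>k. (\<lambda>i. P (Suc i) k) \<longlonglongrightarrow> P_inf k)"
proof -
  interpret jump_lq A C N B D R S \<pi>
    using assms(2,6-8) by unfold_locales (auto simp: generator_matrix_def)
  have eval: "hamiltonian (P (Suc i)) k x (K i k *v x) = 0" for i k x
    using assms(10,11) by (intro lyapunov_imp_hamiltonian_zero) (auto simp: sym_posdef_def)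
  obtain L where L: "\<And>k. sym_posdef (L k)" "solves_riccati A B C D \<pi> N R S L"
    and lim: "\<And>k. (\<lambda>i. P (Suc i) k) \<longlonglongrightarrow> L k"
    using policy_iteration_converges[of "\<lambda>i. P (Suc i)" K, OF assms(10) eval assms(12)] by blast
  have "Q = L" if "\<forall>k. sym_posdef (Q k)" "solves_riccati A B C D \<pi> N R S Q" for Q
    using riccati_unique[OF L] that by blast
  with L lim show ?thesis by blast
qed

end
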